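(* Let $G:\mathbb{R}^d\to[0,\infty)$ satisfy the standing assumptions listed in the context, and assume that $G$ is differentiable with globally Lipschitz continuous gradient. For $t,T>0$ define $$G_T^t(x)=-T\log\left(\frac1{(2\pi Tt)^{d/2}}\int_{\mathbb{R}^d}\exp\left(-\frac{G(y)}{T}-\frac1{2Tt}\|x-y\|^2\right)dy\right),$$ and let $\pi_T^t$ and $\pi^t$ be the probability measures with densities $\pi_T^t(x)\propto\exp(-G_T^t(x))$ and $\pi^t(x)\propto\exp(-M_G^t(x))$. Then for any $t>0$, $$\lim_{T\to0}\|\pi_T^t-\pi^t\|_{\mathrm{TV}}=0.$$
   Context: Notation: $B_R(m)=\{x\in\mathbb{R}^d:\|x-m\|\le R\}$ and $B_R^c(m)=\mathbb{R}^d\setminus B_R(m)$. The (regular) subdifferential of $H:\mathbb{R}^d\to\mathbb{R}$ at $x$ is $\partial H(x)=\{v\in\mathbb{R}^d:\liminf_{y\to x,\,y\ne x}\frac{H(y)-H(x)-\langle v,y-x\rangle}{\|y-x\|}\ge 0\}$. For $t>0$ the Moreau envelope is $M_H^t(x)=\inf_{y\in\mathbb{R}^d}H(y)+\frac1{2t}\|x-y\|^2$ and the proximal map is $\operatorname{prox}_{tH}(x)=\operatorname{argmin}_{y\in\mathbb{R}^d}H(y)+\frac1{2t}\|x-y\|^2$. $\|\mu-\nu\|_{\mathrm{TV}}=\sup_{A}|\mu(A)-\nu(A)|$ over Borel sets $A$. Standing assumptions (the setting $U=G$, $F\equiv0$): $\int\exp(-G(x))\,dx<\infty$, and (1) $G$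 is locally bounded and weakly convex: there is $\rho_G>0$ such that $G+\frac{\rho_G}{2}\|\cdot\|^2$ is convex. (2) $G$ is convex outside a ball: there is $M>0$ such that for all $x,y\in B_M^c(0)$ and $\lambda\in[0,1]$, $G(\lambda x+(1-\lambda)y)\le\lambda G(x)+(1-\lambda)G(y)$. (3) For a fixed $0<t_{\max}<1/\rho_G$ and $\phi(s)=\sup\{\|p\|: p\in\partial G(\operatorname{prox}_{tG}(x)),\ \|x\|\le s,\ 0<t\le t_{\max}\}$, it holds that $\int\phi(\|x\|)^2\exp(-M_G^{t_{\max}}(x))\,dx<\infty$. *)

theory Defs
  imports "HOL-Probability.Probability"
begin

text \<open>
  The space is an arbitrary Euclidean space, with its dimension \<open>DIM('a)\<close> in the role of $d$.
\<close>

definition subdiff :: "('a::euclidean_space \<Rightarrow> real) \<Rightarrow> 'a \<Rightarrow> 'a set" where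
  "subdiff H x =
     {v. Liminf (at x) (\<lambda>y. ereal ((H y - H x - v \<bullet> (y - x)) / norm (y - x))) \<ge> 0}"

text \<open>
  The infimum is taken in the reals, so it is only meaningful for \<open>H\<close> such that the objective is
  bounded below, for instance \<open>H \<ge> 0\<close>.
\<close>
definition moreau_env :: "real \<Rightarrow> ('a::euclidean_space \<Rightarrow> real) \<Rightarrow> 'a \<Rightarrow> real" where
  "moreau_env t H x = (INF y. H y + 1 / (2 * t) * (norm (x - y))\<^sup>2)"

text \<open>The proximal map is the full set of minimisers, which may fail to be a singleton.\<close>
definition prox :: "real \<Rightarrow> ('a::euclidean_space \<Rightarrow> real) \<Rightarrow> 'a \<Rightarrow> 'a set" where
  "prox t H x = {y. is_arg_min (\<lambda>y. H y + 1 / (2 * t) * (norm (x - y))\<^sup>2) (\<lambda>_. True) y}"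

text \<open>The supremum is taken in \<open>[0, \<infinity>]\<close>, since the set of norms may be unbounded.\<close>
definition prox_subgrad_bound ::
    "real \<Rightarrow> ('a::euclidean_space \<Rightarrow> real) \<Rightarrow> real \<Rightarrow> ennreal" where
  "prox_subgrad_bound tmax G s =
     Sup {ennreal (norm p) | p x t y.
            norm x \<le> s \<and> 0 < t \<and> t \<le> tmax \<and> y \<in> prox t G x \<and> p \<in> subdiff G y}"

definition locally_bounded :: "('a::euclidean_space \<Rightarrow> real) \<Rightarrow> bool" where
  "locally_bounded G \<longleftrightarrow> (\<forall>x. \<exists>e>0. bounded (G ` ball x e))"

definition smoothed_potential ::
    "real \<Rightarrow> real \<Rightarrow> ('a::euclidean_space \<Rightarrow> real) \<Rightarrow> 'a \<Rightarrow> real" where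
  "smoothed_potential T t G x =
     - T * ln (1 / (2 * pi * T * t) powr (real DIM('a) / 2) *
       (\<integral>y. exp (- G y / T - 1 / (2 * T * t) * (norm (x - y))\<^sup>2) \<partial>lborel))"

text \<open>
  The measure with density proportional to \<open>exp (- U)\<close>. It is a probability measure iff
  \<open>exp (- U)\<close> is Lebesgue integrable; otherwise the Bochner integral is 0 and so is the measure.
\<close>
definition gibbs :: "('a::euclidean_space \<Rightarrow> real) \<Rightarrow> 'a measure" where
  "gibbs U = density lborel (\<lambda>x. ennreal (exp (- U x) / (\<integral>y. exp (- U y) \<partial>lborel)))"

definition tv_dist :: "'a::topological_space measure \<Rightarrow> 'a measure \<Rightarrow> real" where
  "tv_dist \<mu> \<nu> = (SUP A\<in>sets borel. \<bar>measure \<mu> A - measure \<nu> A\<bar>)"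

end

theory Submission
  imports Defs "HOL-Real_Asymp.Real_Asymp"
begin

text \<open>
  Integrability of \<open>exp (- G)\<close> and convexity outside a ball force \<open>G\<close> to grow at least linearly,
  \<open>a * norm x - b \<le> G x\<close>. Completing the square carries this bound over to the smoothed potentials,
  uniformly in \<open>T < 1\<close>, so that the densities \<open>exp (- smoothed_potential T t G x)\<close> are dominated by a
  multiple of \<open>exp (- (a * norm x))\<close>. By the Laplace principle the smoothed potentials converge
  pointwise to the Moreau envelope as \<open>T \<rightarrow> 0\<close>, and dominated convergence gives convergence in \<open>L\<^sup>1\<close>,
  hence in total variation.
\<close>

section \<open>Gaussian and exponential integrals on a Euclidean space\<close>

text \<open>The squared norm is a sum over coordinates, so the integral factors into one-dimensional
  integrals, each a rescaled normal density of variance \<open>s\<close>.\<close>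

lemma has_bochner_integral_gaussian:
  fixes x :: "'a::euclidean_space"
  assumes s: "0 < s"
  shows "has_bochner_integral lborel (\<lambda>y. exp (- ((norm (x - y))\<^sup>2 / (2 * s))))
           ((2 * pi * s) powr (real DIM('a) / 2))"
proof (rule has_bochner_integral_nn_integral)
  have *: "(\<integral>\<^sup>+z. ennreal (exp (- ((c - z)\<^sup>2 / (2 * s)))) \<partial>lborel) = ennreal (sqrt (2 * pi * s))" for c
  proof -
    have "(\<integral>\<^sup>+z. ennreal (exp (- ((c - z)\<^sup>2 / (2 * s)))) \<partial>lborel)
        = (\<integral>\<^sup>+z. ennreal (sqrt (2 * pi * s) * normal_density c (sqrt s) z) \<partial>lborel)"
      using s by (intro nn_integral_cong) (simp add: normal_density_def power2_commute)
    also have "\<dots> = ennreal (\<integral>z. sqrt (2 * pi * s) * normal_density c (sqrt s) z \<partial>lborel)"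
      using s by (intro nn_integral_eq_integral integrable_mult_right integrable_normal_density) auto
    finally show ?thesis
      using s by simp
  qed
  have "(\<integral>\<^sup>+y. ennreal (exp (- ((norm (x - y))\<^sup>2 / (2 * s)))) \<partial>lborel)
      = (\<integral>\<^sup>+y. (\<Prod>b\<in>Basis. ennreal (exp (- ((x \<bullet> b - y \<bullet> b)\<^sup>2 / (2 * s))))) \<partial>lborel)"
  proof (intro nn_integral_cong)
    fix y :: 'a
    have "(norm (x - y))\<^sup>2 = (\<Sum>b\<in>Basis. (x \<bullet> b - y \<bullet> b)\<^sup>2)"
      unfolding power2_norm_eq_inner euclidean_inner[of "x - y" "x - y"]
      by (simp add: inner_diff_left power2_eq_square)
    then show "ennreal (exp (- ((norm (x - y))\<^sup>2 / (2 * s))))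
        = (\<Prod>b\<in>Basis. ennreal (exp (- ((x \<bullet> b - y \<bullet> b)\<^sup>2 / (2 * s)))))"
      by (simp add: prod_ennreal sum_divide_distrib sum_negf[symmetric] exp_sum)
  qed
  also have "\<dots> = (\<Prod>b\<in>(Basis::'a set). ennreal (sqrt (2 * pi * s)))"
    by (subst nn_integral_lborel_prod) (auto simp: *)
  also have "\<dots> = ennreal ((2 * pi * s) powr (real DIM('a) / 2))"
    using s by (simp add: ennreal_power powr_half_sqrt[symmetric] powr_powr powr_realpow[symmetric])
  finally show "(\<integral>\<^sup>+y. ennreal (exp (- ((norm (x - y))\<^sup>2 / (2 * s)))) \<partial>lborel)
      = ennreal ((2 * pi * s) powr (real DIM('a) / 2))" .
qed (use s in auto)

text \<open>Since \<open>norm x\<close> dominates every coordinate, the function lies below a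
  product of one-dimensional two-sided exponentials, which is integrable by Tonelli.\<close>

lemma integrable_exp_neg_norm:
  assumes a: "0 < a"
  shows "integrable lborel (\<lambda>x::'a::euclidean_space. exp (- (a * norm x)))"
proof -
  \<comment> \<open>The rate is shared among the coordinates, so that the sum of all
    \<open>c * \<bar>x \<bullet> b\<bar>\<close> stays below \<open>a * norm x\<close>.\<close>
  define c where "c = a / DIM('a)"
  have c: "0 < c"
    using a by (simp add: c_def)
  have dens: "integrable lborel (exponential_density c)"
    using prob_space_exponential_density[OF c] c
    by (intro integrableI_nonneg)
      (auto simp: exponential_density_nonneg dest!: prob_space.emeasure_space_1 simp: emeasure_density)
  \<comment> \<open>The exponential density plus its reflection. At 0 both summands count, so it is
    used as a majorant of the two-sided exponential rather than as an equal.\<close>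
  have "integrable lborel (\<lambda>z. exponential_density c z + exponential_density c (0 + (-1) * z))"
    by (intro Bochner_Integration.integrable_add dens lborel_integrable_real_affine) auto
  then have "integrable lborel (\<lambda>z. 1 / c * (exponential_density c z + exponential_density c (0 + (-1) * z)))"
    by (intro integrable_mult_right)
  then have line: "integrable lborel (\<lambda>z::real. exp (- (c * \<bar>z\<bar>)))"
    by (rule Bochner_Integration.integrable_bound)
      (use c in \<open>auto simp: exponential_density_def abs_if field_simps\<close>)
  have "integrable lborel (\<lambda>x::'a. \<Prod>b\<in>Basis. exp (- (c * \<bar>x \<bullet> b\<bar>)))"
  proof (rule integrableI_nonneg)
    have "(\<integral>\<^sup>+(x::'a). (\<Prod>b\<in>Basis. ennreal (exp (- (c * \<bar>x \<bullet> b\<bar>)))) \<partial>lborel)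
        = (\<Prod>b\<in>(Basis::'a set). (\<integral>\<^sup>+z. ennreal (exp (- (c * \<bar>z\<bar>))) \<partial>lborel))"
      by (rule nn_integral_lborel_prod) auto
    also have "\<dots> < \<infinity>"
      using line by (simp add: nn_integral_eq_integral power_less_top_ennreal)
    finally show "(\<integral>\<^sup>+(x::'a). ennreal (\<Prod>b\<in>Basis. exp (- (c * \<bar>x \<bullet> b\<bar>))) \<partial>lborel) < \<infinity>"
      by (simp add: prod_ennreal)
  qed (auto intro!: prod_nonneg)
  moreover have "exp (- (a * norm x)) \<le> (\<Prod>b\<in>Basis. exp (- (c * \<bar>x \<bullet> b\<bar>)))" for x :: 'a
  proof -
    have "(\<Sum>b\<in>Basis. c * \<bar>x \<bullet> b\<bar>) \<le> (\<Sum>b\<in>(Basis::'a set). c * norm x)"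
      using c by (intro sum_mono mult_left_mono Basis_le_norm) auto
    then have "(\<Sum>b\<in>Basis. c * \<bar>x \<bullet> b\<bar>) \<le> a * norm x"
      by (simp add: c_def)
    then show ?thesis
      by (simp add: exp_sum[symmetric] sum_negf)
  qed
  ultimately show ?thesis
    by (elim Bochner_Integration.integrable_bound) (auto simp: abs_of_nonneg prod_nonneg)
qed

section \<open>Linear growth of the potential\<close>

text \<open>Markov's inequality: on the sublevel set \<open>exp c * exp (- G x)\<close> is at least
  1.\<close>

lemma emeasure_sublevel_finite:
  fixes G :: "'a \<Rightarrow> real"
  assumes "integrable M (\<lambda>x. exp (- G x))" and [measurable]: "G \<in> borel_measurable M"
  shows "emeasure M {x\<in>space M. G x \<le> c} < \<infinity>"
proof -
  have "integrable M (\<lambda>x. exp c * exp (- G x))"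
    using assms(1) by simp
  then have "integrable M (indicat_real {x\<in>space M. G x \<le> c})"
    by (rule Bochner_Integration.integrable_bound)
      (auto simp: indicator_def exp_add[symmetric])
  then show ?thesis
    by (simp add: integrable_indicator_iff Int_def conj_commute cong: conj_cong)
qed

text \<open>The convex hull of a ball and a far away point contains many disjoint balls of half the radius.\<close>

lemma sublevel_volume_ge:
  fixes G :: "'a::euclidean_space \<Rightarrow> real"
  assumes convex_outside: "\<And>x y l. M < norm x \<Longrightarrow> M < norm y \<Longrightarrow> l \<in> {0..1} \<Longrightarrow>
      G (l *\<^sub>R x + (1 - l) *\<^sub>R y) \<le> l * G x + (1 - l) * G y"
    and meas [measurable]: "G \<in> borel_measurable borel"
    and fin: "emeasure lborel {x. G x \<le> k} < \<infinity>"
    and near: "\<And>z. dist c z < 1 / 2 \<Longrightarrow> M < norm z \<and> G z \<le> k"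
    and x: "M < norm x" "G x \<le> k" and far: "2 * real N \<le> dist c x"
  shows "real N * measure lborel (ball (0::'a) (1 / 4)) \<le> measure lborel {x. G x \<le> k}"
proof -
  \<comment> \<open>For \<open>i < N\<close> these centres lie on the first half of the segment from
    \<open>c\<close> to \<open>x\<close>, at spacing \<open>dist c x / (2 * N)\<close>, which is at
    least 1.\<close>
  define p where "p i = c + (real i / (2 * real N)) *\<^sub>R (x - c)" for i
  have sub: "ball (p i) (1 / 4) \<subseteq> {x. G x \<le> k}" if i: "i < N" for i
  proof
    fix q assume q: "q \<in> ball (p i) (1 / 4)"
    \<comment> \<open>Because \<open>l\<close> is at most 1/2, dividing by \<open>1 - l\<close> at
      most doubles lengths. So \<open>q\<close> within 1/4 of \<open>p i\<close> is a convex
      combination of \<open>x\<close> and a point \<open>z\<close> within 1/2 of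
      \<open>c\<close>.\<close>
    define l where "l = real i / (2 * real N)"
    have l: "0 \<le> l" "l \<le> 1 / 2"
      using i by (auto simp: l_def field_simps)
    define z where "z = c + (1 / (1 - l)) *\<^sub>R (q - p i)"
    have "(1 / (1 - l)) * norm (q - p i) \<le> 2 * norm (q - p i)"
      using l by (intro mult_right_mono) (auto simp: field_simps)
    also have "\<dots> < 1 / 2"
      using q by (simp add: dist_norm norm_minus_commute)
    finally have z: "dist c z < 1 / 2"
      using l by (simp add: z_def dist_norm)
    have "(1 - l) *\<^sub>R z = (1 - l) *\<^sub>R c + (q - p i)"
      using l by (simp add: z_def scaleR_right_distrib)
    moreover have "p i = c + l *\<^sub>R (x - c)"
      by (simp add: p_def l_def)
    ultimately have "q = l *\<^sub>R x + (1 - l) *\<^sub>R z"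
      by (simp add: scaleR_left_diff_distrib scaleR_right_diff_distrib)
    then have "G q \<le> l * G x + (1 - l) * G z"
      using convex_outside[of x z l] near[OF z] x l by simp
    also have "\<dots> \<le> l * k + (1 - l) * k"
      using near[OF z] x l by (intro add_mono mult_left_mono) auto
    finally show "q \<in> {x. G x \<le> k}"
      by (simp add: algebra_simps)
  qed
  have disj: "disjoint_family_on (\<lambda>i. ball (p i) (1 / 4)) {..<N}"
    unfolding disjoint_family_on_def
  proof (intro ballI impI)
    fix i j assume ij: "i \<in> {..<N}" "j \<in> {..<N}" "i \<noteq> j"
    have "p i - p j = ((real i - real j) / (2 * real N)) *\<^sub>R (x - c)"
      by (simp add: p_def algebra_simps diff_divide_distrib)
    then have "dist (p i) (p j) = \<bar>real i - real j\<bar> / (2 * real N) * dist c x"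
      by (simp add: dist_norm norm_minus_commute)
    also have "\<dots> \<ge> 1 / (2 * real N) * (2 * real N)"
      using ij far by (intro mult_mono divide_right_mono) auto
    finally have "1 \<le> dist (p i) (p j)"
      using ij by simp
    then show "ball (p i) (1 / 4) \<inter> ball (p j) (1 / 4) = {}"
      by (intro disjoint_ballI) auto
  qed
  have "real N * measure lborel (ball (0::'a) (1 / 4)) = (\<Sum>i<N. measure lborel (ball (p i) (1 / 4)))"
    by (simp add: content_ball)
  also have "\<dots> = measure lborel (\<Union>i<N. ball (p i) (1 / 4))"
    using disj emeasure_lborel_ball_finite by (intro measure_finite_Union[symmetric]) (auto simp: less_le)
  also have "\<dots> \<le> measure lborel {x. G x \<le> k}"
    using sub fin by (intro measure_mono_fmeasurable) (auto simp: fmeasurable_def)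
  finally show ?thesis .
qed

text \<open>A far point of low value would give the sublevel set too much volume, so
  \<open>G\<close> exceeds \<open>k + 1\<close> beyond some radius \<open>R\<close>, while it is at
  most \<open>k\<close> on a smaller ball. Convexity along rays outside the ball of radius
  \<open>M\<close> extends this rise by 1 to linear growth.\<close>

lemma linear_growth:
  fixes G :: "'a::euclidean_space \<Rightarrow> real"
  assumes convex_outside: "\<And>x y l. M < norm x \<Longrightarrow> M < norm y \<Longrightarrow> l \<in> {0..1} \<Longrightarrow>
      G (l *\<^sub>R x + (1 - l) *\<^sub>R y) \<le> l * G x + (1 - l) * G y"
    and cont: "continuous_on UNIV G" and nonneg: "\<And>x. 0 \<le> G x" and M: "0 < M"
    and int: "integrable lborel (\<lambda>x. exp (- G x))"
  obtains a b where "0 < a" "\<And>x. a * norm x - b \<le> G x"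
proof -
  have [measurable]: "G \<in> borel_measurable borel"
    using cont by (rule borel_measurable_continuous_onI)
  have "compact (G ` cball 0 (M + 2))"
    by (intro compact_continuous_image continuous_on_subset[OF cont]) auto
  then have "bdd_above (G ` cball 0 (M + 2))"
    by (intro bounded_imp_bdd_above compact_imp_bounded)
  then obtain k where k: "\<And>z. norm z \<le> M + 2 \<Longrightarrow> G z \<le> k"
    unfolding bdd_above_def by fastforce
  have k0: "0 \<le> k"
    using k[of 0] nonneg[of 0] M by simp
  have fin: "emeasure lborel {x. G x \<le> k + 1} < \<infinity>"
    using emeasure_sublevel_finite[OF int, of "k + 1"] by simp
  define v where "v = measure lborel (ball (0::'a) (1 / 4))"
  have v: "0 < v"
    by (simp add: v_def content_ball_pos)
  obtain N where N: "measure lborel {x. G x \<le> k + 1} < real N * v"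
    using reals_Archimedean3[OF v] by blast
  \<comment> \<open>The norm \<open>M + 1\<close> keeps the ball of radius 1/2 around
    \<open>c\<close> outside radius \<open>M\<close>, where convexity holds, and inside radius
    \<open>M + 2\<close>, where \<open>k\<close> bounds \<open>G\<close>.\<close>
  define c :: 'a where "c = (M + 1) *\<^sub>R (SOME b. b \<in> Basis)"
  have c: "norm c = M + 1"
    using M by (simp add: c_def SOME_Basis)
  \<comment> \<open>Chosen so that \<open>norm x - norm c\<close> is at least \<open>2 * N\<close>
    once \<open>norm x\<close> reaches \<open>R\<close>.\<close>
  define R where "R = 2 * real N + 2 * M + 2"
  have far: "k + 1 < G x" if "R \<le> norm x" for x
  proof (rule ccontr)
    assume "\<not> k + 1 < G x"
    moreover have "2 * real N \<le> dist c x"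
      using that c M norm_triangle_ineq2[of x c] by (simp add: R_def dist_norm norm_minus_commute)
    moreover have "M < norm z \<and> G z \<le> k + 1" if "dist c z < 1 / 2" for z
      using that c k[of z] norm_triangle_ineq2[of z c] norm_triangle_ineq2[of c z]
      by (simp add: dist_norm norm_minus_commute)
    moreover have "M < norm x"
      using that M by (simp add: R_def)
    ultimately have "real N * v \<le> measure lborel {x. G x \<le> k + 1}"
      unfolding v_def by (intro sublevel_volume_ge[OF convex_outside _ fin, where c = c and x = x]) auto
    with N show False
      by simp
  qed
  \<comment> \<open>The distance along a ray over which \<open>G\<close> rises by more than 1; the
    slope obtained is \<open>1 / D\<close>.\<close>
  define D where "D = R - (M + 1)"
  have D: "0 < D"
    using M by (simp add: D_def R_def)
  have "1 / D * norm x - R / D \<le> G x" for x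
  proof (cases "R \<le> norm x")
    case True
    define u where "u = (1 / norm x) *\<^sub>R x"
    have n: "M + 1 < norm x"
      using True D by (simp add: D_def)
    then have u: "norm u = 1" "x = norm x *\<^sub>R u"
      using M by (auto simp: u_def)
    \<comment> \<open>The weight that places \<open>R *\<^sub>R u\<close> on the segment between
      \<open>(M + 1) *\<^sub>R u\<close> and \<open>x\<close>.\<close>
    define l where "l = D / (norm x - (M + 1))"
    have l: "0 < l" "l \<le> 1"
      using n D True by (auto simp: l_def D_def)
    have "l * (norm x - (M + 1)) = D"
      using n by (simp add: l_def)
    then have "l * norm x + (1 - l) * (M + 1) = R"
      by (simp add: D_def algebra_simps)
    then have "R *\<^sub>R u = l *\<^sub>R x + (1 - l) *\<^sub>R ((M + 1) *\<^sub>R u)"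
      by (subst u(2)) (simp add: scaleR_left_distrib[symmetric])
    moreover have "M < norm ((M + 1) *\<^sub>R u)" "M < norm x"
      using u M n by auto
    ultimately have "G (R *\<^sub>R u) \<le> l * G x + (1 - l) * G ((M + 1) *\<^sub>R u)"
      using convex_outside[of x "(M + 1) *\<^sub>R u" l] l by simp
    also have "\<dots> \<le> l * G x + (1 - l) * k"
      using l u M by (intro add_mono mult_left_mono k) auto
    also have "\<dots> \<le> l * G x + k"
      using l k0 by (simp add: algebra_simps)
    finally have "1 < l * G x"
      using far[of "R *\<^sub>R u"] u D M by (simp add: D_def)
    then have "(norm x - (M + 1)) / D < G x"
      using n D by (simp add: l_def field_simps)
    moreover have "(norm x - R) / D \<le> (norm x - (M + 1)) / D"
      using D by (intro divide_right_mono) (auto simp: D_def)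
    ultimately show ?thesis
      by (simp add: diff_divide_distrib)
  next
    \<comment> \<open>Inside radius \<open>R\<close> the affine bound is not positive, so
      nonnegativity of \<open>G\<close> suffices.\<close>
    case False
    then have "(norm x - R) / D \<le> 0"
      using D by (simp add: divide_le_0_iff)
    then show ?thesis
      using nonneg[of x] by (simp add: diff_divide_distrib)
  qed
  with D show ?thesis
    by (intro that[of "1 / D"]) auto
qed

section \<open>Elementary bounds for the Moreau envelope\<close>

lemma moreau_env_le:
  assumes "\<And>y. 0 \<le> G y" "0 < t"
  shows "moreau_env t G x \<le> G y + 1 / (2 * t) * (norm (x - y))\<^sup>2"
  unfolding moreau_env_def using assms
  by (intro cINF_lower bdd_belowI2[where m = 0]) auto

lemma moreau_env_nonneg:
  assumes "\<And>y. 0 \<le> G y" "0 < t"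
  shows "0 \<le> moreau_env t G x"
  unfolding moreau_env_def using assms by (intro cINF_greatest) auto

text \<open>Supplies a near minimiser, around which the mass of the smoothing kernel is estimated
  from below.\<close>

lemma moreau_env_approx:
  assumes "\<And>y. 0 \<le> G y" "0 < t" "moreau_env t G x < k"
  obtains y where "G y + 1 / (2 * t) * (norm (x - y))\<^sup>2 < k"
proof -
  have "bdd_below (range (\<lambda>y. G y + 1 / (2 * t) * (norm (x - y))\<^sup>2))"
    using assms by (intro bdd_belowI2[where m = 0]) auto
  then show ?thesis
    using assms(3) that unfolding moreau_env_def by (auto simp: cINF_less_iff)
qed

section \<open>Smoothed potentials and the Laplace principle\<close>

lemma integrable_smoothing_kernel:
  fixes G :: "'a::euclidean_space \<Rightarrow> real"
  assumes nonneg: "\<And>y. 0 \<le> G y" and [measurable]: "G \<in> borel_measurable borel"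
    and T: "0 < T" and t: "0 < t"
  shows "integrable lborel (\<lambda>y. exp (- G y / T - 1 / (2 * T * t) * (norm (x - y))\<^sup>2))"
proof (rule Bochner_Integration.integrable_bound)
  show "integrable lborel (\<lambda>y. exp (- ((norm (x - y))\<^sup>2 / (2 * (T * t)))))"
    using has_bochner_integral_gaussian[of "T * t" x] T t by (auto simp: has_bochner_integral_iff)
qed (use nonneg T in \<open>auto simp: mult.assoc\<close>)

text \<open>Only the mass over the ball is kept, where the integrand is at least
  \<open>exp (- k / T)\<close>.\<close>

lemma smoothing_kernel_integral_ge:
  fixes G :: "'a::euclidean_space \<Rightarrow> real"
  assumes nonneg: "\<And>y. 0 \<le> G y" and meas: "G \<in> borel_measurable borel"
    and T: "0 < T" and t: "0 < t"
    and le: "\<And>z. z \<in> ball y r \<Longrightarrow> G z + 1 / (2 * t) * (norm (x - z))\<^sup>2 \<le> k"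
  shows "exp (- k / T) * measure lborel (ball y r)
      \<le> (\<integral>y. exp (- G y / T - 1 / (2 * T * t) * (norm (x - y))\<^sup>2) \<partial>lborel)"
proof -
  have "exp (- k / T) * measure lborel (ball y r) = (\<integral>z. exp (- k / T) * indicator (ball y r) z \<partial>lborel)"
    by simp
  also have "\<dots> \<le> (\<integral>z. exp (- G z / T - 1 / (2 * T * t) * (norm (x - z))\<^sup>2) \<partial>lborel)"
  proof (intro integral_mono integrable_smoothing_kernel nonneg meas T t)
    show "integrable lborel (\<lambda>z. exp (- k / T) * indicator (ball y r) z)"
      using emeasure_lborel_ball_finite[of y r] by (simp add: integrable_indicator_iff)
    fix z
    show "exp (- k / T) * indicator (ball y r) z \<le> exp (- G z / T - 1 / (2 * T * t) * (norm (x - z))\<^sup>2)"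
    proof (cases "z \<in> ball y r")
      case True
      have "- k / T \<le> - (G z + 1 / (2 * t) * (norm (x - z))\<^sup>2) / T"
        using le[OF True] T by (intro divide_right_mono) auto
      also have "\<dots> = - G z / T - 1 / (2 * T * t) * (norm (x - z))\<^sup>2"
        using T t by (simp add: field_simps)
      finally show ?thesis
        using True by simp
    qed simp
  qed
  finally show ?thesis .
qed

text \<open>By continuity the objective is bounded on a ball around \<open>x\<close>, so the
  preceding lower bound applies. Positivity makes the logarithm in the smoothed potential
  genuine.\<close>

lemma smoothing_kernel_integral_pos:
  fixes G :: "'a::euclidean_space \<Rightarrow> real"
  assumes nonneg: "\<And>y. 0 \<le> G y" and cont: "continuous_on UNIV G"
    and T: "0 < T" and t: "0 < t"
  shows "0 < (\<integral>y. exp (- G y / T - 1 / (2 * T * t) * (norm (x - y))\<^sup>2) \<partial>lborel)"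
proof -
  have meas: "G \<in> borel_measurable borel"
    using cont by (rule borel_measurable_continuous_onI)
  have "compact ((\<lambda>z. G z + 1 / (2 * t) * (norm (x - z))\<^sup>2) ` cball x 1)"
    by (intro compact_continuous_image continuous_intros continuous_on_subset[OF cont]) auto
  then have "bdd_above ((\<lambda>z. G z + 1 / (2 * t) * (norm (x - z))\<^sup>2) ` cball x 1)"
    by (intro bounded_imp_bdd_above compact_imp_bounded)
  then obtain k where "\<And>z. z \<in> ball x 1 \<Longrightarrow> G z + 1 / (2 * t) * (norm (x - z))\<^sup>2 \<le> k"
    unfolding bdd_above_def by fastforce
  then have "exp (- k / T) * measure lborel (ball x 1)
      \<le> (\<integral>y. exp (- G y / T - 1 / (2 * T * t) * (norm (x - y))\<^sup>2) \<partial>lborel)"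
    by (rule smoothing_kernel_integral_ge[OF nonneg meas T t])
  moreover have "0 < exp (- k / T) * measure lborel (ball x 1)"
    by (intro mult_pos_pos content_ball_pos) auto
  ultimately show ?thesis
    by (rule less_le_trans[rotated])
qed

lemma smoothed_potential_eq:
  fixes G :: "'a::euclidean_space \<Rightarrow> real"
  assumes "\<And>y. 0 \<le> G y" "continuous_on UNIV G" and T: "0 < T" and t: "0 < t"
  shows "smoothed_potential T t G x = T * (real DIM('a) / 2) * ln (2 * pi * T * t)
      - T * ln (\<integral>y. exp (- G y / T - 1 / (2 * T * t) * (norm (x - y))\<^sup>2) \<partial>lborel)"
proof -
  have "ln (1 / q powr d * J) = ln J - d * ln q" if "0 < q" "0 < J" for q d J :: real
    using that by (simp add: ln_mult ln_div ln_powr)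
  from this[OF _ smoothing_kernel_integral_pos[OF assms], of "2 * pi * T * t" "real DIM('a) / 2" x]
  show ?thesis
    unfolding smoothed_potential_def using T t by (simp add: right_diff_distrib)
qed

text \<open>The share \<open>e\<close> of the quadratic term is left to form a Gaussian of variance
  \<open>T * t / e\<close>. Its normalisation cancels that of the smoothed potential except for the
  factor \<open>e\<close>, which costs the term with \<open>ln e\<close>.\<close>

lemma smoothed_potential_ge:
  fixes G :: "'a::euclidean_space \<Rightarrow> real"
  assumes nonneg: "\<And>y. 0 \<le> G y" and cont: "continuous_on UNIV G" and T: "0 < T" and t: "0 < t"
    and e: "0 < e"
    and ge: "\<And>y. m + e / (2 * t) * (norm (x - y))\<^sup>2 \<le> G y + 1 / (2 * t) * (norm (x - y))\<^sup>2"
  shows "m + T * (real DIM('a) / 2) * ln e \<le> smoothed_potential T t G x"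
proof -
  have meas: "G \<in> borel_measurable borel"
    using cont by (rule borel_measurable_continuous_onI)
  define J where "J = (\<integral>y. exp (- G y / T - 1 / (2 * T * t) * (norm (x - y))\<^sup>2) \<partial>lborel)"
  have J: "0 < J"
    unfolding J_def by (rule smoothing_kernel_integral_pos[OF nonneg cont T t])
  have gauss: "has_bochner_integral lborel (\<lambda>y. exp (- ((norm (x - y))\<^sup>2 / (2 * (T * t / e)))))
      ((2 * pi * (T * t / e)) powr (real DIM('a) / 2))"
    using T t e by (intro has_bochner_integral_gaussian) auto
  have "J \<le> (\<integral>y. exp (- m / T) * exp (- ((norm (x - y))\<^sup>2 / (2 * (T * t / e)))) \<partial>lborel)"
    unfolding J_def
  proof (intro integral_mono integrable_smoothing_kernel nonneg meas T t integrable_mult_right)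
    show "integrable lborel (\<lambda>y. exp (- ((norm (x - y))\<^sup>2 / (2 * (T * t / e)))))"
      using gauss by (auto simp: has_bochner_integral_iff)
    fix y
    have "- G y / T - 1 / (2 * T * t) * (norm (x - y))\<^sup>2 = - (G y + 1 / (2 * t) * (norm (x - y))\<^sup>2) / T"
      using T t by (simp add: field_simps)
    also have "\<dots> \<le> - (m + e / (2 * t) * (norm (x - y))\<^sup>2) / T"
      using ge[of y] T by (intro divide_right_mono) auto
    also have "\<dots> = - m / T + - ((norm (x - y))\<^sup>2 / (2 * (T * t / e)))"
      using T t e by (simp add: field_simps)
    finally show "exp (- G y / T - 1 / (2 * T * t) * (norm (x - y))\<^sup>2)
        \<le> exp (- m / T) * exp (- ((norm (x - y))\<^sup>2 / (2 * (T * t / e))))"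
      by (simp only: exp_add[symmetric] exp_le_cancel_iff)
  qed
  also have "\<dots> = exp (- m / T) * (2 * pi * (T * t / e)) powr (real DIM('a) / 2)"
    using gauss by (simp add: has_bochner_integral_iff)
  finally have "ln J \<le> ln (exp (- m / T) * (2 * pi * (T * t / e)) powr (real DIM('a) / 2))"
    using J by simp
  also have "\<dots> = - m / T + real DIM('a) / 2 * ln ((2 * pi * T * t) / e)"
    using T t e by (simp add: ln_mult_pos ln_powr mult.assoc)
  also have "\<dots> = - m / T + real DIM('a) / 2 * (ln (2 * pi * T * t) - ln e)"
    using T t e by (subst ln_div) auto
  finally have "T * ln J \<le> T * (- m / T + real DIM('a) / 2 * (ln (2 * pi * T * t) - ln e))"
    using T by (intro mult_left_mono) auto
  also have "\<dots> = - m + T * (real DIM('a) / 2) * ln (2 * pi * T * t) - T * (real DIM('a) / 2) * ln e"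
    using T by (simp add: distrib_left right_diff_distrib)
  finally show ?thesis
    unfolding smoothed_potential_eq[OF nonneg cont T t] J_def by linarith
qed

text \<open>The lower bound trades a small share \<open>e\<close> of the objective for Gaussian
  integrability; the upper bound keeps only a small ball around a near minimiser. All corrections
  vanish with \<open>T\<close>.\<close>

lemma smoothed_potential_tendsto:
  fixes G :: "'a::euclidean_space \<Rightarrow> real"
  assumes nonneg: "\<And>y. 0 \<le> G y" and cont: "continuous_on UNIV G" and t: "0 < t"
  shows "((\<lambda>T. smoothed_potential T t G x) \<longlongrightarrow> moreau_env t G x) (at_right 0)"
proof (rule order_tendstoI)
  let ?m = "moreau_env t G x"
  have m: "0 \<le> ?m"
    using nonneg t by (rule moreau_env_nonneg)
  have pos: "\<forall>\<^sub>F T in at_right (0::real). 0 < T"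
    by (simp add: eventually_at_right_less)
  fix k assume k: "k < ?m"
  \<comment> \<open>Small enough that \<open>(1 - e) * ?m\<close> still exceeds \<open>k\<close>.
    Adding 1 to \<open>?m\<close> avoids a zero denominator, and the minimum with 1/2 keeps
    \<open>e\<close> below 1.\<close>
  define e where "e = min (1 / 2) ((?m - k) / (2 * (?m + 1)))"
  have e: "0 < e" "e < 1"
    using k m by (auto simp: e_def)
  have "e * (?m + 1) \<le> (?m - k) / (2 * (?m + 1)) * (?m + 1)"
    using m by (intro mult_right_mono) (auto simp: e_def)
  also have "\<dots> = (?m - k) / 2"
    using m by (simp add: divide_simps)
  finally have "e * (?m + 1) \<le> (?m - k) / 2" .
  then have em: "k < (1 - e) * ?m"
    using k e by (simp add: algebra_simps)
  \<comment> \<open>The share \<open>1 - e\<close> of the objective is bounded below by the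
    envelope; of the share \<open>e\<close> only the quadratic part is retained, as \<open>G\<close>
    is nonnegative.\<close>
  have ge: "(1 - e) * ?m + e / (2 * t) * (norm (x - y))\<^sup>2 \<le> G y + 1 / (2 * t) * (norm (x - y))\<^sup>2" for y
  proof -
    have "(1 - e) * ?m \<le> (1 - e) * (G y + 1 / (2 * t) * (norm (x - y))\<^sup>2)"
      using e moreau_env_le[OF nonneg t, where x = x and y = y] by (intro mult_left_mono) auto
    moreover have "0 \<le> e * G y"
      using e nonneg by simp
    ultimately show ?thesis
      by (simp add: algebra_simps diff_divide_distrib)
  qed
  have "((\<lambda>T. (1 - e) * ?m + T * (real DIM('a) / 2) * ln e) \<longlongrightarrow> (1 - e) * ?m + 0 * (real DIM('a) / 2) * ln e) (at_right 0)"
    by (intro tendsto_intros)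
  then have "\<forall>\<^sub>F T in at_right 0. k < (1 - e) * ?m + T * (real DIM('a) / 2) * ln e"
    using em by (intro order_tendstoD(1)) auto
  with pos show "\<forall>\<^sub>F T in at_right 0. k < smoothed_potential T t G x"
    by eventually_elim (use smoothed_potential_ge[OF nonneg cont _ t e(1) ge] in fastforce)
next
  let ?m = "moreau_env t G x"
  have pos: "\<forall>\<^sub>F T in at_right (0::real). 0 < T"
    by (simp add: eventually_at_right_less)
  have meas: "G \<in> borel_measurable borel"
    using cont by (rule borel_measurable_continuous_onI)
  fix k assume "?m < k"
  \<comment> \<open>The gap between \<open>k'\<close> and \<open>k\<close> absorbs the terms that
    vanish with \<open>T\<close>.\<close>
  then obtain k' where k': "?m < k'" "k' < k"
    using dense by blast
  obtain y where y: "G y + 1 / (2 * t) * (norm (x - y))\<^sup>2 < k'"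
    using moreau_env_approx[OF nonneg t k'(1)] .
  have "open {z. G z + 1 / (2 * t) * (norm (x - z))\<^sup>2 < k'}"
    by (intro open_Collect_less continuous_intros cont)
  then obtain r where r: "0 < r" "ball y r \<subseteq> {z. G z + 1 / (2 * t) * (norm (x - z))\<^sup>2 < k'}"
    using y unfolding open_contains_ball by blast
  define v where "v = measure lborel (ball y r)"
  have v: "0 < v"
    using r by (simp add: v_def content_ball_pos)
  have le: "smoothed_potential T t G x
      \<le> T * (real DIM('a) / 2) * ln (2 * pi * T * t) + k' - T * ln v" if T: "0 < T" for T
  proof -
    define J where "J = (\<integral>y. exp (- G y / T - 1 / (2 * T * t) * (norm (x - y))\<^sup>2) \<partial>lborel)"
    have "exp (- k' / T) * v \<le> J"
      unfolding J_def v_def using r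
      by (intro smoothing_kernel_integral_ge nonneg meas T t) force
    then have "ln (exp (- k' / T) * v) \<le> ln J"
      using v by (intro ln_mono) auto
    then have "- k' / T + ln v \<le> ln J"
      using v by (simp add: ln_mult)
    then have "T * (- k' / T + ln v) \<le> T * ln J"
      using T by (intro mult_left_mono) auto
    moreover have "T * (- k' / T + ln v) = - k' + T * ln v"
      using T by (simp add: right_diff_distrib)
    ultimately show ?thesis
      unfolding smoothed_potential_eq[OF nonneg cont T t] J_def[symmetric] by linarith
  qed
  have "((\<lambda>T. T * (real DIM('a) / 2) * ln (2 * pi * T * t) + k' - T * ln v) \<longlongrightarrow> k') (at_right 0)"
    using t by real_asymp
  then have "\<forall>\<^sub>F T in at_right 0. T * (real DIM('a) / 2) * ln (2 * pi * T * t) + k' - T * ln v < k"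
    using k' by (intro order_tendstoD(2)) auto
  with pos show "\<forall>\<^sub>F T in at_right 0. smoothed_potential T t G x < k"
    by eventually_elim (use le in fastforce)
qed

text \<open>The lower bound with share 1/2: half of the quadratic term absorbs
  \<open>a * norm (x - y)\<close> at the cost \<open>a\<^sup>2 * t\<close>, and the other half
  remains as the Gaussian. For bounded \<open>T\<close> the loss is uniform.\<close>

lemma smoothed_potential_linear_growth:
  fixes G :: "'a::euclidean_space \<Rightarrow> real"
  assumes nonneg: "\<And>y. 0 \<le> G y" and cont: "continuous_on UNIV G" and T: "0 < T" and t: "0 < t"
    and a: "0 < a" and growth: "\<And>x. a * norm x - b \<le> G x"
  shows "a * norm x - b - a\<^sup>2 * t - T * (real DIM('a) / 2) * ln 2 \<le> smoothed_potential T t G x"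
proof -
  have "a * norm x - b - a\<^sup>2 * t + (1 / 2) / (2 * t) * (norm (x - y))\<^sup>2
      \<le> G y + 1 / (2 * t) * (norm (x - y))\<^sup>2" for y
  proof -
    have "0 \<le> (norm (x - y) - 2 * a * t)\<^sup>2 / (4 * t)"
      using t by simp
    also have "\<dots> = a\<^sup>2 * t - a * norm (x - y) + (1 / (2 * t) - (1 / 2) / (2 * t)) * (norm (x - y))\<^sup>2"
      using t by (simp add: field_simps power2_eq_square)
    finally have "a * norm (x - y) + (1 / 2) / (2 * t) * (norm (x - y))\<^sup>2
        \<le> a\<^sup>2 * t + 1 / (2 * t) * (norm (x - y))\<^sup>2"
      by (simp add: algebra_simps)
    moreover have "a * norm x \<le> a * (norm y + norm (x - y))"
      using a norm_triangle_sub[of x y] by (intro mult_left_mono) auto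
    ultimately show ?thesis
      using growth[of y] by (simp add: algebra_simps)
  qed
  from smoothed_potential_ge[OF nonneg cont T t _ this] show ?thesis
    by (simp add: ln_div)
qed

lemma borel_measurable_smoothed_potential [measurable]:
  assumes [measurable]: "G \<in> borel_measurable borel"
  shows "smoothed_potential T t G \<in> borel_measurable borel"
  unfolding smoothed_potential_def[abs_def] by measurable

section \<open>Gibbs measures and total variation\<close>

text \<open>A zero integral would force the strictly positive integrand to vanish almost everywhere,
  but the whole space is not a null set.\<close>

lemma integral_exp_pos:
  fixes U :: "'a::euclidean_space \<Rightarrow> real"
  assumes "integrable lborel (\<lambda>x. exp (U x))"
  shows "0 < (\<integral>x. exp (U x) \<partial>lborel)"
proof -
  have "\<not> (AE x in lborel. exp (U x) = 0)"
    by (simp add: AE_iff_measurable[OF _ refl])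
  then have "(\<integral>x. exp (U x) \<partial>lborel) \<noteq> 0"
    by (subst integral_nonneg_eq_0_iff_AE[OF assms]) auto
  moreover have "0 \<le> (\<integral>x. exp (U x) \<partial>lborel)"
    by (intro integral_nonneg_AE) auto
  ultimately show ?thesis
    by (simp add: less_le)
qed

lemma prob_space_gibbs:
  assumes "integrable lborel (\<lambda>x. exp (- U x))"
  shows "prob_space (gibbs U)"
proof
  let ?Z = "\<integral>x. exp (- U x) \<partial>lborel"
  have [measurable]: "(\<lambda>x. exp (- U x)) \<in> borel_measurable borel"
    using borel_measurable_integrable[OF assms] by simp
  have "emeasure (gibbs U) (space (gibbs U)) = (\<integral>\<^sup>+x. ennreal (exp (- U x) / ?Z) \<partial>lborel)"
    by (simp add: gibbs_def emeasure_density)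
  also have "\<dots> = ennreal (\<integral>x. exp (- U x) / ?Z \<partial>lborel)"
    using assms integral_exp_pos[OF assms] by (intro nn_integral_eq_integral) auto
  finally show "emeasure (gibbs U) (space (gibbs U)) = 1"
    using integral_exp_pos[OF assms] by simp
qed

lemma measure_gibbs:
  assumes "integrable lborel (\<lambda>x. exp (- U x))" and A: "A \<in> sets borel"
  shows "measure (gibbs U) A = (\<integral>x. indicator A x * (exp (- U x) / (\<integral>y. exp (- U y) \<partial>lborel)) \<partial>lborel)"
proof -
  let ?Z = "\<integral>x. exp (- U x) \<partial>lborel"
  have [measurable]: "(\<lambda>x. exp (- U x)) \<in> borel_measurable borel"
    using borel_measurable_integrable[OF assms(1)] by simp
  have "emeasure (gibbs U) A = (\<integral>\<^sup>+x. ennreal (indicator A x * (exp (- U x) / ?Z)) \<partial>lborel)"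
    using A by (auto simp: gibbs_def emeasure_density indicator_def intro!: nn_integral_cong)
  also have "\<dots> = ennreal (\<integral>x. indicator A x * (exp (- U x) / ?Z) \<partial>lborel)"
    using assms integral_exp_pos[OF assms(1)]
      integrable_mult_indicator[of A lborel "\<lambda>x. exp (- U x) / ?Z"]
    by (intro nn_integral_eq_integral) auto
  finally show ?thesis
    using integral_exp_pos[OF assms(1)]
    by (simp add: measure_def enn2real_ennreal Bochner_Integration.integral_nonneg)
qed

text \<open>Total variation is at most the \<open>L^1\<close> distance of the densities; the sharp
  factor 1/2 is dropped, as only convergence to 0 is at stake.\<close>

lemma tv_dist_gibbs_le:
  fixes U V :: "'a::euclidean_space \<Rightarrow> real"
  assumes U: "integrable lborel (\<lambda>x. exp (- U x))" and V: "integrable lborel (\<lambda>x. exp (- V x))"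
  shows "\<bar>tv_dist (gibbs U) (gibbs V)\<bar>
      \<le> (\<integral>x. \<bar>exp (- U x) / (\<integral>y. exp (- U y) \<partial>lborel) - exp (- V x) / (\<integral>y. exp (- V y) \<partial>lborel)\<bar> \<partial>lborel)"
    (is "_ \<le> ?B")
proof -
  let ?u = "\<lambda>x. exp (- U x) / (\<integral>y. exp (- U y) \<partial>lborel)"
  let ?v = "\<lambda>x. exp (- V x) / (\<integral>y. exp (- V y) \<partial>lborel)"
  have le: "\<bar>measure (gibbs U) A - measure (gibbs V) A\<bar> \<le> ?B" if A: "A \<in> sets borel" for A
  proof -
    have ind: "integrable lborel (\<lambda>x. indicator A x * ?u x)" "integrable lborel (\<lambda>x. indicator A x * ?v x)"
      using U V A integrable_mult_indicator[of A lborel ?u] integrable_mult_indicator[of A lborel ?v]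
      by simp_all
    have "measure (gibbs U) A - measure (gibbs V) A
        = (\<integral>x. indicator A x * ?u x - indicator A x * ?v x \<partial>lborel)"
      using ind by (simp add: measure_gibbs[OF U A] measure_gibbs[OF V A])
    then have "\<bar>measure (gibbs U) A - measure (gibbs V) A\<bar>
        \<le> (\<integral>x. \<bar>indicator A x * ?u x - indicator A x * ?v x\<bar> \<partial>lborel)"
      by (simp only: integral_abs_bound)
    also have "\<dots> \<le> ?B"
    proof (rule integral_mono)
      show "integrable lborel (\<lambda>x. \<bar>indicator A x * ?u x - indicator A x * ?v x\<bar>)"
        using ind by (intro integrable_abs Bochner_Integration.integrable_diff)
      show "integrable lborel (\<lambda>x. \<bar>?u x - ?v x\<bar>)"
        using U V by (intro integrable_abs Bochner_Integration.integrable_diff integrable_divide_zero) auto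
      show "\<bar>indicator A x * ?u x - indicator A x * ?v x\<bar> \<le> \<bar>?u x - ?v x\<bar>" for x
        by (cases "x \<in> A") simp_all
    qed
    finally show ?thesis .
  qed
  have "tv_dist (gibbs U) (gibbs V) \<le> ?B"
    unfolding tv_dist_def by (rule cSUP_least[OF _ le]) auto
  \<comment> \<open>The empty set contributes 0 to the supremum, and \<open>le\<close> provides the
    boundedness that the real supremum requires.\<close>
  moreover have "0 \<le> tv_dist (gibbs U) (gibbs V)"
    unfolding tv_dist_def by (rule cSUP_upper2[OF bdd_aboveI2[OF le], where x = "{}"]) auto
  ultimately show ?thesis
    by simp
qed

text \<open>Dominated convergence gives convergence of the unnormalised densities in
  \<open>L^1\<close> and of their normalising constants. It is stated for sequences, as dominated
  convergence is.\<close>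

lemma tv_dist_gibbs_tendsto:
  fixes U :: "nat \<Rightarrow> 'a::euclidean_space \<Rightarrow> real" and V :: "'a \<Rightarrow> real"
  assumes meas [measurable]: "\<And>n. U n \<in> borel_measurable borel"
    and lim: "\<And>x. (\<lambda>n. U n x) \<longlonglongrightarrow> V x"
    and bound: "\<And>n x. exp (- U n x) \<le> w x" and w: "integrable lborel w"
  shows "integrable lborel (\<lambda>x. exp (- V x))"
    and "(\<lambda>n. tv_dist (gibbs (U n)) (gibbs V)) \<longlonglongrightarrow> 0"
proof -
  have [measurable]: "V \<in> borel_measurable borel"
    using meas lim by (rule borel_measurable_LIMSEQ_real[rotated])
  have lim_exp: "(\<lambda>n. exp (- U n x)) \<longlonglongrightarrow> exp (- V x)" for x
    by (intro tendsto_intros lim)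
  have int_U: "integrable lborel (\<lambda>x. exp (- U n x))" for n
    using w by (rule Bochner_Integration.integrable_bound) (auto intro!: AE_I2 order.trans[OF bound])
  have bound_V: "exp (- V x) \<le> w x" for x
    by (rule LIMSEQ_le_const2[OF lim_exp]) (use bound in auto)
  show int_V: "integrable lborel (\<lambda>x. exp (- V x))"
    using w by (rule Bochner_Integration.integrable_bound) (auto intro!: AE_I2 order.trans[OF bound_V])
  define Z where "Z n = (\<integral>x. exp (- U n x) \<partial>lborel)" for n
  define W where "W = (\<integral>x. exp (- V x) \<partial>lborel)"
  have Z: "0 < Z n" for n
    unfolding Z_def using int_U by (rule integral_exp_pos)
  have W: "0 < W"
    unfolding W_def using int_V by (rule integral_exp_pos)
  have "Z \<longlonglongrightarrow> W"
    unfolding Z_def[abs_def] W_def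
    by (rule integral_dominated_convergence[OF _ _ w]) (use lim_exp bound in auto)
  have "(\<lambda>n. \<integral>x. \<bar>exp (- U n x) - exp (- V x)\<bar> \<partial>lborel) \<longlonglongrightarrow> (\<integral>x. 0 \<partial>(lborel :: 'a measure))"
  proof (rule integral_dominated_convergence)
    show "integrable lborel (\<lambda>x. w x + w x)"
      using w by simp
    show "AE x in lborel. norm \<bar>exp (- U n x) - exp (- V x)\<bar> \<le> w x + w x" for n
    proof (rule AE_I2)
      fix x
      show "norm \<bar>exp (- U n x) - exp (- V x)\<bar> \<le> w x + w x"
        using bound[of n x] bound_V[of x] exp_ge_zero[of "- U n x"] exp_ge_zero[of "- V x"]
        unfolding real_norm_def by linarith
    qed
    show "AE x in lborel. (\<lambda>n. \<bar>exp (- U n x) - exp (- V x)\<bar>) \<longlonglongrightarrow> 0"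
      using lim_exp by (intro AE_I2 tendsto_rabs_zero LIM_zero)
  qed auto
  then have "(\<lambda>n. (\<integral>x. \<bar>exp (- U n x) - exp (- V x)\<bar> \<partial>lborel) / Z n + \<bar>1 / Z n - 1 / W\<bar> * W)
      \<longlonglongrightarrow> 0 / W + \<bar>1 / W - 1 / W\<bar> * W"
    using \<open>Z \<longlonglongrightarrow> W\<close> W by (intro tendsto_intros) auto
  then have lim0: "(\<lambda>n. (\<integral>x. \<bar>exp (- U n x) - exp (- V x)\<bar> \<partial>lborel) / Z n + \<bar>1 / Z n - 1 / W\<bar> * W) \<longlonglongrightarrow> 0"
    by simp
  have "\<bar>tv_dist (gibbs (U n)) (gibbs V)\<bar>
      \<le> (\<integral>x. \<bar>exp (- U n x) - exp (- V x)\<bar> \<partial>lborel) / Z n + \<bar>1 / Z n - 1 / W\<bar> * W" for n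
  proof -
    have "\<bar>tv_dist (gibbs (U n)) (gibbs V)\<bar> \<le> (\<integral>x. \<bar>exp (- U n x) / Z n - exp (- V x) / W\<bar> \<partial>lborel)"
      using tv_dist_gibbs_le[OF int_U int_V] by (simp add: Z_def W_def)
    also have "\<dots> \<le> (\<integral>x. \<bar>exp (- U n x) - exp (- V x)\<bar> / Z n + \<bar>1 / Z n - 1 / W\<bar> * exp (- V x) \<partial>lborel)"
    proof (rule integral_mono)
      fix x
      \<comment> \<open>Separates the change of the unnormalised density from that of the
        normalising constant.\<close>
      have "exp (- U n x) / Z n - exp (- V x) / W
          = (exp (- U n x) - exp (- V x)) / Z n + (1 / Z n - 1 / W) * exp (- V x)"
        by (simp add: algebra_simps diff_divide_distrib)
      then show "\<bar>exp (- U n x) / Z n - exp (- V x) / W\<bar>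
          \<le> \<bar>exp (- U n x) - exp (- V x)\<bar> / Z n + \<bar>1 / Z n - 1 / W\<bar> * exp (- V x)"
        using abs_triangle_ineq[of "(exp (- U n x) - exp (- V x)) / Z n" "(1 / Z n - 1 / W) * exp (- V x)"] Z[of n]
        by (simp add: abs_mult)
    qed (use int_U int_V in auto)
    also have "\<dots> = (\<integral>x. \<bar>exp (- U n x) - exp (- V x)\<bar> \<partial>lborel) / Z n + \<bar>1 / Z n - 1 / W\<bar> * W"
      using int_U int_V by (simp add: W_def)
    finally show ?thesis .
  qed
  then have "(\<lambda>n. \<bar>tv_dist (gibbs (U n)) (gibbs V)\<bar>) \<longlonglongrightarrow> 0"
    by (intro tendsto_sandwich[OF _ _ tendsto_const lim0]) auto
  then show "(\<lambda>n. tv_dist (gibbs (U n)) (gibbs V)) \<longlonglongrightarrow> 0"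
    by (rule tendsto_rabs_zero_cancel)
qed

section \<open>Convergence of the Gibbs measures as the temperature tends to 0\<close>

text \<open>The conclusion includes that the measures are probability measures, since
  \<open>gibbs\<close> would be the zero measure for a potential whose exponential is not
  integrable.\<close>

theorem proposition4p25:
  fixes G :: "'a::euclidean_space \<Rightarrow> real" and g :: "'a \<Rightarrow> 'a"
    and \<rho> M tmax L t :: real
  assumes nonneg: "\<forall>x. 0 \<le> G x"
    and exp_integrable: "integrable lborel (\<lambda>x. exp (- G x))"
    and loc_bdd: "locally_bounded G"
    and rho_pos: "0 < \<rho>"
    and weakly_convex: "convex_on UNIV (\<lambda>x. G x + \<rho> / 2 * (norm x)\<^sup>2)"
    and M_pos: "0 < M"
    and convex_outside: "\<forall>x\<in>- cball 0 M. \<forall>y\<in>- cball 0 M. \<forall>l\<in>{0..1}.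
          G (l *\<^sub>R x + (1 - l) *\<^sub>R y) \<le> l * G x + (1 - l) * G y"
    and tmax: "0 < tmax" "tmax < 1 / \<rho>"
    and subgrad_integrable:
      "(\<integral>\<^sup>+ x. (prox_subgrad_bound tmax G (norm x))\<^sup>2 * ennreal (exp (- moreau_env tmax G x)) \<partial>lborel) < \<infinity>"
    and gradient: "\<forall>x. GDERIV G x :> g x"
    and lipschitz_gradient: "L-lipschitz_on UNIV g"
    and t_pos: "0 < t"
  shows "(\<forall>T>0. prob_space (gibbs (smoothed_potential T t G))) \<and>
         prob_space (gibbs (moreau_env t G)) \<and>
         ((\<lambda>T. tv_dist (gibbs (smoothed_potential T t G)) (gibbs (moreau_env t G)))
            \<longlongrightarrow> 0) (at_right 0)"
proof -
  have nn: "\<And>x. 0 \<le> G x"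
    using nonneg by blast
  have cont: "continuous_on UNIV G"
    using gradient unfolding gderiv_def
    by (blast intro: continuous_at_imp_continuous_on has_derivative_continuous)
  then have [measurable]: "G \<in> borel_measurable borel"
    by (rule borel_measurable_continuous_onI)
  obtain a b where a: "0 < a" and growth: "\<And>x. a * norm x - b \<le> G x"
    by (rule linear_growth[OF _ cont nn M_pos exp_integrable]) (use convex_outside in auto)
  \<comment> \<open>Keeping \<open>T\<close> as a parameter serves two purposes: \<open>w T\<close>
    shows integrability for each single \<open>T\<close>, and \<open>w 1\<close> is a common
    majorant for all \<open>T\<close> below 1.\<close>
  define w where "w T x = exp (b + a\<^sup>2 * t + T * (real DIM('a) / 2) * ln 2) * exp (- (a * norm x))"
    for T and x :: 'a
  have w: "integrable lborel (w T)" for T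
    unfolding w_def using a by (intro integrable_mult_right integrable_exp_neg_norm)
  have le_w: "exp (- smoothed_potential T t G x) \<le> w T x" if "0 < T" for T x
    unfolding w_def exp_add[symmetric]
    using smoothed_potential_linear_growth[OF nn cont that t_pos a growth, of x] by simp
  have w_mono: "w T x \<le> w 1 x" if "T < 1" for T x
    unfolding w_def using that by (intro mult_right_mono) auto
  have limit: "integrable lborel (\<lambda>x. exp (- moreau_env t G x)) \<and>
      (\<lambda>n. tv_dist (gibbs (smoothed_potential (T n) t G)) (gibbs (moreau_env t G))) \<longlonglongrightarrow> 0"
    if T: "\<And>n. 0 < T n" "\<And>n. T n < 1" "T \<longlonglongrightarrow> 0" for T :: "nat \<Rightarrow> real"
  proof -
    have "filterlim T (at_right 0) sequentially"
      using T by (intro tendsto_imp_filterlim_at_right) auto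
    then have "(\<lambda>n. smoothed_potential (T n) t G x) \<longlonglongrightarrow> moreau_env t G x" for x
      by (rule filterlim_compose[OF smoothed_potential_tendsto[OF nn cont t_pos]])
    moreover have "exp (- smoothed_potential (T n) t G x) \<le> w 1 x" for n x
      using le_w w_mono T order.trans by blast
    ultimately show ?thesis
      by (intro conjI tv_dist_gibbs_tendsto[where U = "\<lambda>n. smoothed_potential (T n) t G" and w = "w 1"] w)
        measurable
  qed
  have "prob_space (gibbs (smoothed_potential T t G))" if "0 < T" for T
    using w[of T] by (rule prob_space_gibbs[OF Bochner_Integration.integrable_bound])
      (auto intro!: AE_I2 order.trans[OF le_w[OF that]])
  moreover have "prob_space (gibbs (moreau_env t G))"
    \<comment> \<open>Any admissible sequence yields integrability for the envelope; the shift by 2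
      keeps the values strictly below 1.\<close>
    using limit[of "\<lambda>n. 1 / (real n + 2)"] LIMSEQ_ignore_initial_segment[OF lim_1_over_n, of 2]
    by (intro prob_space_gibbs) (auto simp: add.commute)
  moreover have "((\<lambda>T. tv_dist (gibbs (smoothed_potential T t G)) (gibbs (moreau_env t G))) \<longlongrightarrow> 0) (at_right 0)"
    \<comment> \<open>A right limit at 0 may be tested along sequences in the open interval from 0
      to 1.\<close>
    using limit by (intro tendsto_at_right_sequentially[of 0 1]) auto
  ultimately show ?thesis
    by blast
qed

end
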